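(* Let $\alpha$ and $\beta$ be irrational numbers. Then: (i) There exists a joint coboundary for $T_\alpha$ and $T_\beta$ acting in $C(\mathbb T)$ which is not a double coboundary, not even in $L_1(\mathbb T)$; that is, there exists $\psi\in(I-T_\alpha)C(\mathbb T)\cap(I-T_\beta)C(\mathbb T)$ such that there is no $h\in L_1(\mathbb T)$ with $(I-T_\alpha)(I-T_\beta)h=\psi$. (ii) For fixed $p\in[1,\infty)$, there exists a joint coboundary for $T_\alpha$ and $T_\beta$ acting in $L_p(\mathbb T)$ which is not a double coboundary in $L_1(\mathbb T)$; that is, there exists $\psi\in(I-T_\alpha)L_p(\mathbb T)\cap(I-T_\beta)L_p(\mathbb T)$ with $\psi\notin(I-T_\alpha)(I-T_\beta)L_1(\mathbb T)$.
   Context: $\mathbb T$ is the unit circle in $\mathbb C$ with normalized Lebesgue measure, and for real $\alpha$ and a function $f$ on $\mathbb T$, $T_\alpha f(z)=f(e^{2\pi i\alpha}z)$. Equalities involving elements of $L_p(\mathbb T)$ are understood almost everywhere. *)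

theory Defs
  imports "HOL-Probability.Probability"
begin

text \<open>Functions on the unit circle are represented by functions of type
  \<open>complex \<Rightarrow> complex\<close>; all notions below depend only on their values on \<open>sphere 0 1\<close>.\<close>

abbreviation circle :: "complex set" where
  "circle \<equiv> sphere 0 1"

definition circle_measure :: "complex measure" where
  "circle_measure =
     distr (uniform_measure lborel {0..<1::real}) (restrict_space borel circle)
       (\<lambda>t. exp (2 * of_real pi * \<i> * of_real t))"

lemma space_circle_measure: "space circle_measure = circle"
  by (simp add: circle_measure_def space_restrict_space)

lemma sets_circle_measure: "sets circle_measure = sets (restrict_space borel circle)"
  by (simp add: circle_measure_def)

lemma prob_space_circle_measure: "prob_space circle_measure"
proof -
  interpret U: prob_space "uniform_measure lborel {0..<1::real}"
    by (rule prob_space_uniform_measure) auto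
  have "(\<lambda>t::real. exp (2 * of_real pi * \<i> * of_real t) :: complex) \<in> borel_measurable lborel"
    by measurable
  then have "(\<lambda>t::real. exp (2 * of_real pi * \<i> * of_real t) :: complex)
      \<in> uniform_measure lborel {0..<1} \<rightarrow>\<^sub>M restrict_space borel circle"
    by (intro measurable_restrict_space2) (auto simp: norm_exp_eq_Re)
  then show ?thesis
    unfolding circle_measure_def by (rule U.prob_space_distr)
qed

definition C_circle :: "(complex \<Rightarrow> complex) set" where
  "C_circle = {f. continuous_on circle f}"

text \<open>Representatives of elements of \<open>L\<^sub>p\<close>, which are not identified when equal almost everywhere.\<close>

definition Lp_circle :: "real \<Rightarrow> (complex \<Rightarrow> complex) set" where
  "Lp_circle p = {f \<in> borel_measurable circle_measure.
     integrable circle_measure (\<lambda>z. norm (f z) powr p)}"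

definition rot :: "real \<Rightarrow> (complex \<Rightarrow> complex) \<Rightarrow> complex \<Rightarrow> complex" where
  "rot \<alpha> f z = f (exp (2 * of_real pi * \<i> * of_real \<alpha>) * z)"

definition I_minus_rot :: "real \<Rightarrow> (complex \<Rightarrow> complex) \<Rightarrow> complex \<Rightarrow> complex" where
  "I_minus_rot \<alpha> f z = f z - rot \<alpha> f z"

definition coboundaries_C :: "real \<Rightarrow> (complex \<Rightarrow> complex) set" where
  "coboundaries_C \<alpha> = {\<psi> \<in> C_circle. \<exists>f\<in>C_circle. \<forall>z\<in>circle. I_minus_rot \<alpha> f z = \<psi> z}"

definition coboundaries_Lp :: "real \<Rightarrow> real \<Rightarrow> (complex \<Rightarrow> complex) set" where
  "coboundaries_Lp p \<alpha> =
     {\<psi> \<in> Lp_circle p. \<exists>f\<in>Lp_circle p. AE z in circle_measure. I_minus_rot \<alpha> f z = \<psi> z}"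

end

theory Submission
  imports Defs
begin

text \<open>In terms of Fourier coefficients, \<open>(I - T\<^sub>\<alpha>)(I - T\<^sub>\<beta>)h = \<psi>\<close> means that
  \<open>(1 - \<lambda>\<^sup>n)(1 - \<mu>\<^sup>n)\<close> times the \<open>n\<close>-th coefficient of \<open>h\<close> is that of \<open>\<psi>\<close>, where
  \<open>\<lambda> = exp (2\<pi>i\<alpha>)\<close> and \<open>\<mu> = exp (2\<pi>i\<beta>)\<close>.
  By Dirichlet's theorem there are \<open>n\<^sub>k\<close> for which \<open>d\<^sub>k = \<bar>1 - \<lambda>^n\<^sub>k\<bar>\<close> and \<open>e\<^sub>k = \<bar>1 - \<mu>^n\<^sub>k\<bar>\<close> are
  simultaneously smaller than \<open>4^-k\<close>. With \<open>a\<^sub>k = 2^-k min d\<^sub>k e\<^sub>k\<close>, the function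
  \<open>\<psi>(z) = \<Sum>k. a\<^sub>k z^n\<^sub>k\<close> is a continuous coboundary for both rotations because
  \<open>\<Sum>k. a\<^sub>k / d\<^sub>k\<close> and \<open>\<Sum>k. a\<^sub>k / e\<^sub>k\<close> converge, whereas \<open>a\<^sub>k / (d\<^sub>k e\<^sub>k) = 2^-k / max d\<^sub>k e\<^sub>k > 2^k\<close>
  rules out an integrable \<open>h\<close>, whose Fourier coefficients would be bounded.\<close>

section \<open>The parametrization of the circle by the reals modulo 1\<close>

abbreviation cexp1 :: "real \<Rightarrow> complex" where
  "cexp1 t \<equiv> exp (2 * of_real pi * \<i> * of_real t)"

lemma norm_cexp1 [simp]: "norm (cexp1 t) = 1"
  by (simp add: norm_exp_eq_Re)

lemma cexp1_add: "cexp1 (s + t) = cexp1 s * cexp1 t"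
  by (simp add: exp_add [symmetric] algebra_simps)

lemma cexp1_power: "cexp1 t ^ n = cexp1 (real n * t)"
  by (simp add: exp_of_nat_mult [symmetric] algebra_simps)

lemma cexp1_eq_1_iff: "cexp1 t = 1 \<longleftrightarrow> t \<in> \<int>"
proof -
  have "cexp1 t = 1 \<longleftrightarrow> (\<exists>n::int. 2 * pi * t = of_int (2 * n) * pi)"
    by (simp add: exp_eq_1)
  also have "\<dots> \<longleftrightarrow> (\<exists>n::int. t = of_int n)"
    by (auto simp: field_simps)
  finally show ?thesis
    by (auto simp: Ints_def)
qed

lemma cexp1_frac: "cexp1 (frac t) = cexp1 t"
proof -
  have "cexp1 t = cexp1 (of_int \<lfloor>t\<rfloor> + frac t)"
    by (simp add: frac_def)
  also have "\<dots> = cexp1 (of_int \<lfloor>t\<rfloor>) * cexp1 (frac t)"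
    by (rule cexp1_add)
  also have "cexp1 (of_int \<lfloor>t\<rfloor>) = 1"
    unfolding cexp1_eq_1_iff by simp
  finally show ?thesis by simp
qed

text \<open>This is where irrationality enters: no factor \<open>1 - cexp1 \<alpha> ^ n\<close> with
  \<open>n > 0\<close> vanishes, so the coboundary equation can be solved one coefficient at a
  time.\<close>

lemma cexp1_power_ne_1:
  assumes "\<alpha> \<notin> \<rat>" "n > 0"
  shows "cexp1 \<alpha> ^ n \<noteq> 1"
proof
  assume "cexp1 \<alpha> ^ n = 1"
  then have "real n * \<alpha> \<in> \<rat>"
    unfolding cexp1_power cexp1_eq_1_iff using Ints_subset_Rats by blast
  then have "real n * \<alpha> / real n \<in> \<rat>"
    by (intro Rats_divide) auto
  with assms show False by simp
qed

section \<open>Measurability on the circle and rotation invariance of its measure\<close>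

lemma measurable_circle_measure_eq:
  "measurable circle_measure N = measurable (restrict_space borel circle) N"
  by (rule measurable_cong_sets) (simp_all add: sets_circle_measure)

lemma continuous_on_circle_measurable:
  "continuous_on circle f \<Longrightarrow> f \<in> borel_measurable circle_measure" for f :: "complex \<Rightarrow> complex"
  unfolding measurable_circle_measure_eq by (rule borel_measurable_continuous_on_restrict)

lemma measurable_rotation:
  assumes "norm c = 1"
  shows "(\<lambda>z. c * z) \<in> circle_measure \<rightarrow>\<^sub>M circle_measure"
proof -
  have "(\<lambda>z. c * z) \<in> circle_measure \<rightarrow>\<^sub>M restrict_space borel circle"
    using assms
    by (intro measurable_restrict_space2 continuous_on_circle_measurable continuous_intros)
       (auto simp: space_circle_measure norm_mult)
  then show ?thesis
    by (simp cong: measurable_cong_sets add: sets_circle_measure)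
qed

lemma measurable_cexp1: "cexp1 \<in> borel \<rightarrow>\<^sub>M restrict_space borel circle"
proof (rule measurable_restrict_space2)
  show "cexp1 \<in> borel_measurable borel"
    by (intro borel_measurable_continuous_onI continuous_intros)
qed simp

lemma nn_integral_circle_measure:
  assumes "f \<in> borel_measurable circle_measure"
  shows "(\<integral>\<^sup>+z. f z \<partial>circle_measure) = (\<integral>\<^sup>+t. f (cexp1 t) * indicator {0..<1} t \<partial>lborel)"
proof -
  have f: "f \<in> borel_measurable (restrict_space borel circle)"
    using assms by (simp add: measurable_circle_measure_eq)
  have fc: "(\<lambda>t. f (cexp1 t)) \<in> borel_measurable borel"
    using measurable_compose [OF measurable_cexp1 f] .
  have c: "cexp1 \<in> uniform_measure lborel {0..<1} \<rightarrow>\<^sub>M restrict_space borel circle"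
    using measurable_cexp1 by (simp cong: measurable_cong_sets)
  show ?thesis
    unfolding circle_measure_def using f fc
    by (simp add: nn_integral_distr [OF c] nn_integral_uniform_measure divide_ennreal_def)
qed

text \<open>Translation turns the left side into an integral over \<open>{s..<1+s}\<close>. This
  interval is cut at 1, and periodicity moves the piece beyond 1 back to \<open>{0..<s}\<close>,
  which completes \<open>{s..<1}\<close> to the unit interval.\<close>

lemma nn_integral_periodic_shift:
  fixes g :: "real \<Rightarrow> ennreal"
  assumes g [measurable]: "g \<in> borel_measurable borel"
    and per: "\<And>t. g (t + 1) = g t" and s: "0 \<le> s" "s < 1"
  shows "(\<integral>\<^sup>+t. g (s + t) * indicator {0..<1} t \<partial>lborel) = (\<integral>\<^sup>+t. g t * indicator {0..<1} t \<partial>lborel)"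
proof -
  have "(\<integral>\<^sup>+t. g t * indicator {1..<1+s} t \<partial>lborel)
      = (\<integral>\<^sup>+t. g (1 + 1 * t) * indicator {1..<1+s} (1 + 1 * t) \<partial>lborel)"
    by (subst nn_integral_real_affine [where c = 1 and t = 1]) auto
  also have "\<dots> = (\<integral>\<^sup>+t. g t * indicator {0..<s} t \<partial>lborel)"
    using per by (intro nn_integral_cong) (auto simp: indicator_def add.commute)
  finally have wrap: "(\<integral>\<^sup>+t. g t * indicator {1..<1+s} t \<partial>lborel)
      = (\<integral>\<^sup>+t. g t * indicator {0..<s} t \<partial>lborel)" .
  have "(\<integral>\<^sup>+t. g t * indicator {s..<1+s} t \<partial>lborel)
      = (\<integral>\<^sup>+t. g (s + 1 * t) * indicator {s..<1+s} (s + 1 * t) \<partial>lborel)"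
    by (subst nn_integral_real_affine [where c = 1 and t = s]) auto
  also have "\<dots> = (\<integral>\<^sup>+t. g (s + t) * indicator {0..<1} t \<partial>lborel)"
    by (intro nn_integral_cong) (auto simp: indicator_def)
  finally have "(\<integral>\<^sup>+t. g (s + t) * indicator {0..<1} t \<partial>lborel)
      = (\<integral>\<^sup>+t. g t * indicator {s..<1+s} t \<partial>lborel)" ..
  also have "\<dots> = (\<integral>\<^sup>+t. g t * indicator {s..<1} t + g t * indicator {1..<1+s} t \<partial>lborel)"
    using s by (intro nn_integral_cong) (auto simp: indicator_def)
  also have "\<dots> = (\<integral>\<^sup>+t. g t * indicator {s..<1} t \<partial>lborel) + (\<integral>\<^sup>+t. g t * indicator {0..<s} t \<partial>lborel)"
    by (subst nn_integral_add) (auto simp: wrap)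
  also have "\<dots> = (\<integral>\<^sup>+t. g t * indicator {s..<1} t + g t * indicator {0..<s} t \<partial>lborel)"
    by (subst nn_integral_add) auto
  also have "\<dots> = (\<integral>\<^sup>+t. g t * indicator {0..<1} t \<partial>lborel)"
    using s by (intro nn_integral_cong) (auto simp: indicator_def)
  finally show ?thesis .
qed

text \<open>Pulled back along \<open>cexp1\<close>, a rotation becomes a translation of the line and
  the indicator of a set becomes a function of period 1, so invariance reduces to
  \<open>nn_integral_periodic_shift\<close>.\<close>

lemma distr_rotation: "distr circle_measure circle_measure (\<lambda>z. cexp1 \<alpha> * z) = circle_measure"
proof (rule measure_eqI)
  fix A assume "A \<in> sets (distr circle_measure circle_measure (\<lambda>z. cexp1 \<alpha> * z))"
  then have A [measurable]: "A \<in> sets circle_measure"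
    by simp
  define g :: "real \<Rightarrow> ennreal" where "g t = indicator A (cexp1 t)" for t
  have "(indicator A :: complex \<Rightarrow> ennreal) \<in> borel_measurable (restrict_space borel circle)"
    using A by (intro borel_measurable_indicator) (simp add: sets_circle_measure)
  from measurable_compose [OF measurable_cexp1 this]
  have g: "g \<in> borel_measurable borel"
    by (simp add: g_def [abs_def])
  have per: "g (t + 1) = g t" for t
    using cexp1_eq_1_iff [of 1] by (simp only: g_def cexp1_add) simp
  note rot [measurable] = measurable_rotation [OF norm_cexp1, of \<alpha>]
  have "emeasure (distr circle_measure circle_measure (\<lambda>z. cexp1 \<alpha> * z)) A
      = (\<integral>\<^sup>+z. indicator A z \<partial>distr circle_measure circle_measure (\<lambda>z. cexp1 \<alpha> * z))"
    using A by (subst nn_integral_indicator) simp_all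
  also have "\<dots> = (\<integral>\<^sup>+z. indicator A (cexp1 \<alpha> * z) \<partial>circle_measure)"
    by (rule nn_integral_distr [OF rot]) simp
  also have "\<dots> = (\<integral>\<^sup>+t. indicator A (cexp1 \<alpha> * cexp1 t) * indicator {0..<1} t \<partial>lborel)"
    by (rule nn_integral_circle_measure) measurable
  \<comment> \<open>Only \<alpha> modulo 1 matters for the rotation; passing to
    \<open>frac \<alpha>\<close> brings the shift into the range [0,1) required by the translation
    lemma.\<close>
  also have "\<dots> = (\<integral>\<^sup>+t. g (frac \<alpha> + t) * indicator {0..<1} t \<partial>lborel)"
    unfolding g_def cexp1_add cexp1_frac ..
  also have "\<dots> = (\<integral>\<^sup>+t. g t * indicator {0..<1} t \<partial>lborel)"
    by (rule nn_integral_periodic_shift [OF g per]) (simp_all add: frac_lt_1)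
  also have "\<dots> = (\<integral>\<^sup>+z. indicator A z \<partial>circle_measure)"
    unfolding g_def by (rule nn_integral_circle_measure [symmetric]) simp
  also have "\<dots> = emeasure circle_measure A"
    by simp
  finally show "emeasure (distr circle_measure circle_measure (\<lambda>z. cexp1 \<alpha> * z)) A
      = emeasure circle_measure A" .
qed simp

section \<open>Fourier coefficients and the effect of rotations on them\<close>

interpretation circle: prob_space circle_measure
  by (rule prob_space_circle_measure)

lemma integrable_rot:
  assumes "integrable circle_measure f"
  shows "integrable circle_measure (rot \<alpha> f)"
proof -
  have "integrable circle_measure (\<lambda>z. f (cexp1 \<alpha> * z))"
    by (rule integrable_distr [OF measurable_rotation]) (simp_all add: distr_rotation assms)
  then show ?thesis
    unfolding rot_def [abs_def] .
qed

lemma integral_rot: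
  assumes "f \<in> borel_measurable circle_measure"
  shows "(\<integral>z. rot \<alpha> f z \<partial>circle_measure) = (\<integral>z. f z \<partial>circle_measure)"
proof -
  have "(\<integral>z. f z \<partial>circle_measure)
      = (\<integral>z. f z \<partial>distr circle_measure circle_measure (\<lambda>z. cexp1 \<alpha> * z))"
    by (simp only: distr_rotation)
  also have "\<dots> = (\<integral>z. f (cexp1 \<alpha> * z) \<partial>circle_measure)"
    by (rule integral_distr [OF measurable_rotation assms]) simp
  finally show ?thesis
    by (simp add: rot_def)
qed

lemma integrable_I_minus_rot:
  "integrable circle_measure f \<Longrightarrow> integrable circle_measure (I_minus_rot \<alpha> f)"
  unfolding I_minus_rot_def [abs_def] by (intro Bochner_Integration.integrable_diff integrable_rot)

text \<open>On the circle \<open>cnj z ^ n\<close> is the inverse of \<open>z ^ n\<close>, so this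
  is the usual coefficient at a frequency \<open>n \<ge> 0\<close>. The functions to be tested are
  series in non-negative powers of \<open>z\<close>.\<close>

definition fourier :: "(complex \<Rightarrow> complex) \<Rightarrow> nat \<Rightarrow> complex" where
  "fourier f n = (\<integral>z. f z * cnj z ^ n \<partial>circle_measure)"

lemma integrable_fourier:
  assumes "integrable circle_measure f"
  shows "integrable circle_measure (\<lambda>z. f z * cnj z ^ n)"
proof (rule Bochner_Integration.integrable_bound [OF assms])
  have [measurable]: "(\<lambda>z. cnj z ^ n) \<in> borel_measurable circle_measure"
    by (intro continuous_on_circle_measurable continuous_intros)
  have [measurable]: "f \<in> borel_measurable circle_measure"
    using assms by simp
  show "(\<lambda>z. f z * cnj z ^ n) \<in> borel_measurable circle_measure"
    by measurable
qed (auto simp: norm_mult norm_power space_circle_measure)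

text \<open>The bound does not depend on \<open>n\<close>. An integrable solution of the double
  coboundary equation will be excluded by forcing its coefficients to be unbounded.\<close>

lemma norm_fourier_le:
  assumes "integrable circle_measure f"
  shows "norm (fourier f n) \<le> (\<integral>z. norm (f z) \<partial>circle_measure)"
proof -
  have "norm (fourier f n) \<le> (\<integral>z. norm (f z * cnj z ^ n) \<partial>circle_measure)"
    unfolding fourier_def by (rule integral_norm_bound)
  also have "\<dots> = (\<integral>z. norm (f z) \<partial>circle_measure)"
    by (intro Bochner_Integration.integral_cong)
       (auto simp: norm_mult norm_power space_circle_measure)
  finally show ?thesis .
qed

text \<open>Rotating the whole integrand multiplies the character \<open>cnj z ^ n\<close> by
  \<open>cnj (cexp1 \<alpha>) ^ n\<close>, which \<open>cexp1 \<alpha> ^ n\<close> compensates; the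
  integral itself is invariant.\<close>

lemma fourier_rot:
  assumes "integrable circle_measure f"
  shows "fourier (rot \<alpha> f) n = cexp1 \<alpha> ^ n * fourier f n"
proof -
  have "cexp1 \<alpha> * cnj (cexp1 \<alpha>) = 1"
    using complex_norm_square [of "cexp1 \<alpha>"] by simp
  then have *: "cexp1 \<alpha> ^ n * cnj (cexp1 \<alpha>) ^ n = 1"
    by (metis power_mult_distrib power_one)
  have "rot \<alpha> f z * cnj z ^ n = cexp1 \<alpha> ^ n * rot \<alpha> (\<lambda>z. f z * cnj z ^ n) z" for z
    using * by (simp add: rot_def power_mult_distrib mult_ac)
  then have "fourier (rot \<alpha> f) n
      = (\<integral>z. cexp1 \<alpha> ^ n * rot \<alpha> (\<lambda>z. f z * cnj z ^ n) z \<partial>circle_measure)"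
    unfolding fourier_def by simp
  also have "\<dots> = cexp1 \<alpha> ^ n * (\<integral>z. rot \<alpha> (\<lambda>z. f z * cnj z ^ n) z \<partial>circle_measure)"
    by (rule integral_mult_right_zero)
  also have "(\<integral>z. rot \<alpha> (\<lambda>z. f z * cnj z ^ n) z \<partial>circle_measure) = fourier f n"
    unfolding fourier_def
    using integrable_fourier [OF assms] by (intro integral_rot) auto
  finally show ?thesis .
qed

lemma fourier_I_minus_rot:
  assumes "integrable circle_measure f"
  shows "fourier (I_minus_rot \<alpha> f) n = (1 - cexp1 \<alpha> ^ n) * fourier f n"
proof -
  have "fourier (I_minus_rot \<alpha> f) n
      = (\<integral>z. f z * cnj z ^ n - rot \<alpha> f z * cnj z ^ n \<partial>circle_measure)"
    by (simp add: fourier_def I_minus_rot_def algebra_simps)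
  also have "\<dots> = fourier f n - fourier (rot \<alpha> f) n"
    unfolding fourier_def
    by (intro Bochner_Integration.integral_diff integrable_fourier integrable_rot assms)
  finally show ?thesis
    by (simp add: fourier_rot [OF assms] algebra_simps)
qed

section \<open>Continuous functions as elements of the Lebesgue spaces\<close>

lemma continuous_on_circle_bounded:
  fixes f :: "complex \<Rightarrow> complex"
  assumes "continuous_on circle f"
  obtains B where "\<And>z. z \<in> circle \<Longrightarrow> norm (f z) \<le> B"
proof -
  have "bounded (f ` circle)"
    by (intro compact_imp_bounded compact_continuous_image assms compact_sphere)
  then show ?thesis
    using that unfolding bounded_iff by blast
qed

lemma integrable_continuous_on_circle:
  fixes f :: "complex \<Rightarrow> complex"
  assumes "continuous_on circle f"
  shows "integrable circle_measure f"
proof -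
  obtain B where "\<And>z. z \<in> circle \<Longrightarrow> norm (f z) \<le> B"
    using continuous_on_circle_bounded [OF assms] by blast
  then show ?thesis
    by (intro circle.integrable_const_bound [where B = B] continuous_on_circle_measurable assms)
       (auto simp: space_circle_measure intro!: AE_I2)
qed

lemma integrable_Lp_circle_1:
  assumes "h \<in> Lp_circle 1"
  shows "integrable circle_measure h"
proof -
  have "integrable circle_measure (\<lambda>z. norm (h z))"
    using assms by (simp add: Lp_circle_def)
  with assms show ?thesis
    by (simp add: Lp_circle_def integrable_norm_iff)
qed

lemma C_circle_subset_Lp_circle:
  assumes "0 \<le> p"
  shows "C_circle \<subseteq> Lp_circle p"
proof
  fix f assume "f \<in> C_circle"
  then have f: "continuous_on circle f"
    by (simp add: C_circle_def)
  have [measurable]: "f \<in> borel_measurable circle_measure"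
    by (rule continuous_on_circle_measurable [OF f])
  obtain B where "\<And>z. z \<in> circle \<Longrightarrow> norm (f z) \<le> B"
    using continuous_on_circle_bounded [OF f] by blast
  then have "integrable circle_measure (\<lambda>z. norm (f z) powr p)"
    using assms
    by (intro circle.integrable_const_bound [where B = "B powr p"])
       (auto simp: space_circle_measure intro!: powr_mono2)
  then show "f \<in> Lp_circle p"
    by (simp add: Lp_circle_def)
qed

text \<open>Through this inclusion a witness for the continuous case also settles the case of
  exponent \<open>p\<close>.\<close>

lemma coboundaries_C_subset_Lp:
  assumes "0 \<le> p"
  shows "coboundaries_C \<alpha> \<subseteq> coboundaries_Lp p \<alpha>"
  using C_circle_subset_Lp_circle [OF assms]
  by (fastforce simp: coboundaries_C_def coboundaries_Lp_def space_circle_measure intro!: AE_I2)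

section \<open>Absolutely convergent power series, their coefficients and coboundaries\<close>

lemma fourier_power: "fourier (\<lambda>z. z ^ m) n = (if m = n then 1 else 0)"
proof (cases "m = n")
  case True
  have "z ^ n * cnj z ^ n = 1" if "z \<in> circle" for z
    using that complex_norm_square [of z] by (simp add: power_mult_distrib [symmetric])
  then have "fourier (\<lambda>z. z ^ n) n = (\<integral>z. 1 \<partial>circle_measure)"
    unfolding fourier_def by (intro Bochner_Integration.integral_cong) (auto simp: space_circle_measure)
  with True show ?thesis
    by (simp add: circle.prob_space)
next
  case False
  \<comment> \<open>Chosen so that \<open>(m - n) * \<theta>\<close> is one half: the factors
    \<open>cexp1 \<theta> ^ m\<close> and \<open>cexp1 \<theta> ^ n\<close> then differ. Computing
    the coefficient of the rotated monomial in two ways forces it to be 0.\<close>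
  define \<theta> where "\<theta> = 1 / (2 * (real m - real n))"
  have \<theta>: "real m * \<theta> = real n * \<theta> + 1 / 2"
    using False by (simp add: \<theta>_def field_simps)
  have half: "cexp1 (1 / 2) \<noteq> 1"
    unfolding cexp1_eq_1_iff by (auto elim!: Ints_cases simp: field_simps)
  have ne: "cexp1 \<theta> ^ m \<noteq> cexp1 \<theta> ^ n"
    unfolding cexp1_power \<theta> cexp1_add using half by simp
  have int: "integrable circle_measure (\<lambda>z. z ^ m)"
    by (intro integrable_continuous_on_circle continuous_intros)
  have "cexp1 \<theta> ^ m * fourier (\<lambda>z. z ^ m) n = fourier (rot \<theta> (\<lambda>z. z ^ m)) n"
    by (simp add: fourier_def rot_def power_mult_distrib mult.assoc)
  also have "\<dots> = cexp1 \<theta> ^ n * fourier (\<lambda>z. z ^ m) n"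
    by (rule fourier_rot [OF int])
  finally have "fourier (\<lambda>z. z ^ m) n = 0"
    using ne by simp
  with False show ?thesis by simp
qed

lemma continuous_on_circle_series:
  fixes b :: "nat \<Rightarrow> complex" and N :: "nat \<Rightarrow> nat"
  assumes "summable (\<lambda>k. norm (b k))"
  shows "continuous_on circle (\<lambda>z. \<Sum>k. b k * z ^ N k)"
proof -
  have "uniform_limit circle (\<lambda>n z. \<Sum>k<n. b k * z ^ N k) (\<lambda>z. \<Sum>k. b k * z ^ N k) sequentially"
    by (rule Weierstrass_m_test [OF _ assms]) (simp add: norm_mult norm_power)
  then show ?thesis
    by (rule uniform_limit_theorem [rotated])
       (auto intro!: always_eventually continuous_intros)
qed

text \<open>Absolute summability permits integration term by term. Several indices may share an
  exponent, so the coefficient is a sum over all \<open>k\<close> with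
  \<open>N k = n\<close>.\<close>

lemma fourier_series_sums:
  fixes b :: "nat \<Rightarrow> complex" and N :: "nat \<Rightarrow> nat"
  assumes b: "summable (\<lambda>k. norm (b k))"
  shows "(\<lambda>k. if N k = n then b k else 0) sums fourier (\<lambda>z. \<Sum>k. b k * z ^ N k) n"
proof -
  have norm: "norm (b k * z ^ N k * cnj z ^ n) = norm (b k)" if "z \<in> circle" for k z
    using that by (simp add: norm_mult norm_power)
  have "(\<lambda>k. \<integral>z. b k * z ^ N k * cnj z ^ n \<partial>circle_measure)
      sums (\<integral>z. (\<Sum>k. b k * z ^ N k * cnj z ^ n) \<partial>circle_measure)"
  proof (rule sums_integral)
    show "integrable circle_measure (\<lambda>z. b k * z ^ N k * cnj z ^ n)" for k
      by (intro integrable_continuous_on_circle continuous_intros)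
    show "AE z in circle_measure. summable (\<lambda>k. norm (b k * z ^ N k * cnj z ^ n))"
      using b by (intro AE_I2) (simp add: norm space_circle_measure)
    have "(\<integral>z. norm (b k * z ^ N k * cnj z ^ n) \<partial>circle_measure) = norm (b k)" for k
    proof -
      have "(\<integral>z. norm (b k * z ^ N k * cnj z ^ n) \<partial>circle_measure) = (\<integral>z. norm (b k) \<partial>circle_measure)"
        by (intro Bochner_Integration.integral_cong refl norm) (simp add: space_circle_measure)
      then show ?thesis
        by (simp add: circle.prob_space)
    qed
    with b show "summable (\<lambda>k. \<integral>z. norm (b k * z ^ N k * cnj z ^ n) \<partial>circle_measure)"
      by simp
  qed
  also have "(\<lambda>k. \<integral>z. b k * z ^ N k * cnj z ^ n \<partial>circle_measure) = (\<lambda>k. if N k = n then b k else 0)"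
  proof
    fix k
    have "(\<integral>z. b k * z ^ N k * cnj z ^ n \<partial>circle_measure) = b k * fourier (\<lambda>z. z ^ N k) n"
      by (simp add: fourier_def mult.assoc)
    then show "(\<integral>z. b k * z ^ N k * cnj z ^ n \<partial>circle_measure) = (if N k = n then b k else 0)"
      by (simp add: fourier_power)
  qed
  also have "(\<integral>z. (\<Sum>k. b k * z ^ N k * cnj z ^ n) \<partial>circle_measure) = fourier (\<lambda>z. \<Sum>k. b k * z ^ N k) n"
    unfolding fourier_def
  proof (intro Bochner_Integration.integral_cong refl)
    fix z assume "z \<in> space circle_measure"
    then have "summable (\<lambda>k. norm (b k * z ^ N k))"
      using b by (simp add: space_circle_measure norm_mult norm_power)
    then show "(\<Sum>k. b k * z ^ N k * cnj z ^ n) = (\<Sum>k. b k * z ^ N k) * cnj z ^ n"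
      by (rule suminf_mult2 [OF summable_norm_cancel, symmetric])
  qed
  finally show ?thesis .
qed

text \<open>Non-negative coefficients cannot cancel, so terms with the same exponent as the
  \<open>k\<close>-th can only increase the sum.\<close>

lemma coeff_le_norm_fourier_series:
  fixes a :: "nat \<Rightarrow> real" and N :: "nat \<Rightarrow> nat"
  assumes a: "summable a" "\<And>k. 0 \<le> a k"
  shows "a k \<le> norm (fourier (\<lambda>z. \<Sum>k. of_real (a k) * z ^ N k) (N k))"
proof -
  let ?c = "fourier (\<lambda>z. \<Sum>k. of_real (a k) * z ^ N k) (N k)"
  have "summable (\<lambda>k. norm (complex_of_real (a k)))"
    using a by simp
  \<comment> \<open>Real parts make the terms comparable by order; the modulus is recovered at the
    end from \<open>Re c \<le> norm c\<close>.\<close>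
  from sums_Re [OF fourier_series_sums [OF this]]
  have sums: "(\<lambda>j. if N j = N k then a j else 0) sums Re ?c"
    by (simp add: if_distrib cong: if_cong)
  have "(\<Sum>j\<in>{k}. if N j = N k then a j else 0) \<le> (\<Sum>j. if N j = N k then a j else 0)"
    using a sums by (intro sum_le_suminf) (auto simp: sums_iff)
  then have "a k \<le> Re ?c"
    using sums by (simp add: sums_iff)
  also have "\<dots> \<le> norm ?c"
    by (rule complex_Re_le_cmod)
  finally show ?thesis .
qed

text \<open>Dividing each coefficient by \<open>1 - cexp1 \<alpha> ^ N k\<close> gives a formal
  solution. The second bound on \<open>a\<close> makes the quotients at most
  \<open>(1/2) ^ k\<close> in modulus, so the solution converges uniformly and is
  continuous.\<close>

lemma series_in_coboundaries_C:
  fixes a :: "nat \<Rightarrow> real" and N :: "nat \<Rightarrow> nat"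
  assumes nz: "\<And>k. cexp1 \<alpha> ^ N k \<noteq> 1"
    and a: "\<And>k. 0 \<le> a k" "\<And>k. a k \<le> (1/2) ^ k * norm (1 - cexp1 \<alpha> ^ N k)"
  shows "(\<lambda>z. \<Sum>k. of_real (a k) * z ^ N k) \<in> coboundaries_C \<alpha>"
proof -
  define c where "c k = 1 - cexp1 \<alpha> ^ N k" for k
  define b where "b k = of_real (a k) / c k" for k
  have c: "c k \<noteq> 0" for k
    using nz [of k] by (simp add: c_def)
  have bc: "b k * c k = of_real (a k)" for k
    using c by (simp add: b_def)
  have "norm (b k) \<le> (1/2) ^ k" for k
    using a [of k] c [of k] by (simp add: b_def norm_divide c_def [symmetric] divide_le_eq)
  then have sb: "summable (\<lambda>k. norm (b k))"
    by (intro summable_comparison_test' [OF summable_geometric [of "1/2::real"]]) auto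
  \<comment> \<open>Since the factors \<open>c k\<close> are bounded, summability passes from the
    solution \<open>b\<close> to the given coefficients \<open>a\<close>, and their series is
    continuous as well.\<close>
  have "norm (c k) \<le> 2" for k
    using norm_triangle_ineq4 [of 1 "cexp1 \<alpha> ^ N k"] by (simp add: c_def norm_power)
  then have "norm (b k * c k) \<le> norm (b k) * 2" for k
    by (simp add: norm_mult mult_left_mono)
  then have sa: "summable (\<lambda>k. norm (complex_of_real (a k)))"
    unfolding bc by (intro summable_comparison_test' [OF summable_mult2 [OF sb, of 2]]) auto
  have "I_minus_rot \<alpha> (\<lambda>z. \<Sum>k. b k * z ^ N k) z = (\<Sum>k. of_real (a k) * z ^ N k)"
    if z: "z \<in> circle" for z
  proof -
    \<comment> \<open>Stated for arbitrary \<open>w\<close> because it is applied both at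
      \<open>z\<close> and at the rotated point.\<close>
    have *: "summable (\<lambda>k. b k * w ^ N k)" if "w \<in> circle" for w
      by (rule summable_norm_cancel) (use sb that in \<open>simp add: norm_mult norm_power\<close>)
    have "I_minus_rot \<alpha> (\<lambda>z. \<Sum>k. b k * z ^ N k) z
        = (\<Sum>k. b k * z ^ N k - b k * (cexp1 \<alpha> * z) ^ N k)"
      unfolding I_minus_rot_def rot_def
      using z by (intro suminf_diff * ) (auto simp: norm_mult)
    also have "\<dots> = (\<Sum>k. b k * c k * z ^ N k)"
      by (simp add: c_def power_mult_distrib algebra_simps)
    finally show ?thesis
      by (simp only: bc)
  qed
  with continuous_on_circle_series [OF sa] continuous_on_circle_series [OF sb]
  show ?thesis
    unfolding coboundaries_C_def C_circle_def by blast
qed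

section \<open>Simultaneous Diophantine approximation\<close>

lemma norm_one_minus_cexp1_le: "norm (1 - cexp1 t) \<le> 2 * pi * \<bar>t - of_int m\<bar>"
proof -
  have "cexp1 t = cexp1 (of_int m + (t - of_int m))"
    by simp
  also have "\<dots> = cexp1 (of_int m) * cexp1 (t - of_int m)"
    by (rule cexp1_add)
  also have "cexp1 (of_int m) = 1"
    unfolding cexp1_eq_1_iff by simp
  finally have "norm (1 - cexp1 t) = norm (exp (\<i> * of_real (2 * pi * (t - of_int m))) - 1)"
    by (simp add: norm_minus_commute mult_ac)
  \<comment> \<open>A chord of the unit circle is twice the sine of half the angle that it
    subtends.\<close>
  also have "\<dots> = 2 * \<bar>sin (pi * (t - of_int m))\<bar>"
    unfolding dist_exp_i_1 by simp
  also have "\<dots> \<le> 2 * \<bar>pi * (t - of_int m)\<bar>"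
    by (intro mult_left_mono abs_sin_x_le_abs_x) simp
  finally show ?thesis
    by (simp add: abs_mult)
qed

lemma simultaneous_power_near_1:
  assumes "\<epsilon> > 0"
  obtains n where "n > 0" "norm (1 - cexp1 \<alpha> ^ n) < \<epsilon>" "norm (1 - cexp1 \<beta> ^ n) < \<epsilon>"
proof -
  \<comment> \<open>Dirichlet's theorem gives distance below \<open>1 / M\<close> to an integer,
    which the chord estimate turns into \<open>2 * pi / M\<close>; this choice makes that smaller
    than \<epsilon>.\<close>
  obtain M :: nat where M: "2 * pi / \<epsilon> < real M"
    using reals_Archimedean2 by blast
  have "0 < 2 * pi / \<epsilon>"
    using assms by simp
  with M have "0 < real M"
    by linarith
  then have M0: "0 < M"
    by simp
  define \<theta> where "\<theta> i = (if i = 0 then \<alpha> else \<beta>)" for i :: nat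
  obtain q p where q: "0 < q"
    and qp: "\<And>i. i < 2 \<Longrightarrow> \<bar>of_int q * \<theta> i - of_int (p i)\<bar> < 1 / M"
    using Dirichlet_approx_simult [OF M0, where n = 2 and \<theta> = \<theta>] by blast
  have *: "norm (1 - cexp1 (\<theta> i) ^ nat q) < \<epsilon>" if "i < 2" for i
  proof -
    have "norm (1 - cexp1 (\<theta> i) ^ nat q) \<le> 2 * pi * \<bar>of_int q * \<theta> i - of_int (p i)\<bar>"
      using norm_one_minus_cexp1_le [of "of_int q * \<theta> i" "p i"] q
      by (simp only: cexp1_power of_nat_nat less_imp_le)
    also have "\<dots> < 2 * pi * (1 / M)"
      using qp [OF that] by (intro mult_strict_left_mono) auto
    also have "\<dots> < \<epsilon>"
      using M assms \<open>0 < real M\<close> by (simp add: field_simps)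
    finally show ?thesis .
  qed
  show ?thesis
    using that [of "nat q"] * [of 0] * [of 1] q by (simp add: \<theta>_def)
qed

section \<open>Construction of the joint coboundary\<close>

lemma exists_joint_not_double_coboundary:
  fixes \<alpha> \<beta> :: real
  assumes "\<alpha> \<notin> \<rat>" and "\<beta> \<notin> \<rat>"
  obtains \<psi> where "\<psi> \<in> coboundaries_C \<alpha>" "\<psi> \<in> coboundaries_C \<beta>"
    "\<not> (\<exists>h \<in> Lp_circle 1. AE z in circle_measure. I_minus_rot \<alpha> (I_minus_rot \<beta> h) z = \<psi> z)"
proof -
  have "\<forall>k. \<exists>n>0. norm (1 - cexp1 \<alpha> ^ n) < (1/4) ^ k \<and> norm (1 - cexp1 \<beta> ^ n) < (1/4) ^ k"
    using simultaneous_power_near_1 by (metis zero_less_divide_1_iff zero_less_numeral zero_less_power)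
  then obtain N where N: "\<And>k. N k > 0" "\<And>k. norm (1 - cexp1 \<alpha> ^ N k) < (1/4) ^ k"
      "\<And>k. norm (1 - cexp1 \<beta> ^ N k) < (1/4) ^ k"
    by metis
  define d where "d k = norm (1 - cexp1 \<alpha> ^ N k)" for k
  define e where "e k = norm (1 - cexp1 \<beta> ^ N k)" for k
  \<comment> \<open>The minimum gives \<open>a k \<le> (1/2) ^ k * d k\<close> and
    \<open>a k \<le> (1/2) ^ k * e k\<close> at once, as \<open>series_in_coboundaries_C\<close>
    demands for the two rotations.\<close>
  define a where "a k = (1/2) ^ k * min (d k) (e k)" for k
  define \<psi> where "\<psi> z = (\<Sum>k. of_real (a k) * z ^ N k)" for z :: complex
  have nz: "cexp1 \<alpha> ^ N k \<noteq> 1" "cexp1 \<beta> ^ N k \<noteq> 1" for k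
    using N(1) assms cexp1_power_ne_1 by auto
  then have pos: "0 < d k" "0 < e k" for k
    by (auto simp: d_def e_def)
  have a0: "0 \<le> a k" for k
    using pos [of k] by (simp add: a_def)
  have \<psi>\<alpha>: "\<psi> \<in> coboundaries_C \<alpha>"
    unfolding \<psi>_def [abs_def] using nz(1) a0
    by (rule series_in_coboundaries_C) (simp add: a_def d_def)
  have \<psi>\<beta>: "\<psi> \<in> coboundaries_C \<beta>"
    unfolding \<psi>_def [abs_def] using nz(2) a0
    by (rule series_in_coboundaries_C) (simp add: a_def e_def)
  have "\<not> (\<exists>h \<in> Lp_circle 1. AE z in circle_measure. I_minus_rot \<alpha> (I_minus_rot \<beta> h) z = \<psi> z)"
  proof
    assume "\<exists>h \<in> Lp_circle 1. AE z in circle_measure. I_minus_rot \<alpha> (I_minus_rot \<beta> h) z = \<psi> z"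
    then obtain h where h: "integrable circle_measure h"
      and ae: "AE z in circle_measure. I_minus_rot \<alpha> (I_minus_rot \<beta> h) z = \<psi> z"
      using integrable_Lp_circle_1 by blast
    have \<psi>_int: "integrable circle_measure \<psi>"
      using \<psi>\<alpha> by (intro integrable_continuous_on_circle) (simp add: coboundaries_C_def C_circle_def)
    \<comment> \<open>The double equation would make one fixed number, the norm of \<open>h\<close>
      in \<open>L\<^sub>1\<close>, exceed every power of 2.\<close>
    have bound: "2 ^ k \<le> (\<integral>z. norm (h z) \<partial>circle_measure)" for k
    proof -
      have sa: "summable a"
      proof (rule summable_comparison_test' [OF summable_geometric [of "1/2::real"]])
        fix k
        \<comment> \<open>With this crude bound, the geometric weight alone majorizes
          \<open>a k\<close>.\<close>
        have "d k \<le> 1"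
          using N(2) [of k] power_le_one [of "1/4::real" k] by (simp add: d_def)
        then show "norm (a k) \<le> (1/2) ^ k"
          using a0 [of k] by (simp add: a_def mult_le_cancel_left1 min_le_iff_disj)
      qed simp
      have "fourier \<psi> (N k) = fourier (I_minus_rot \<alpha> (I_minus_rot \<beta> h)) (N k)"
        unfolding fourier_def
      proof (rule integral_cong_AE)
        show "(\<lambda>z. \<psi> z * cnj z ^ N k) \<in> borel_measurable circle_measure"
          using integrable_fourier [OF \<psi>_int] by simp
        show "(\<lambda>z. I_minus_rot \<alpha> (I_minus_rot \<beta> h) z * cnj z ^ N k) \<in> borel_measurable circle_measure"
          using integrable_fourier [OF integrable_I_minus_rot [OF integrable_I_minus_rot [OF h]]]
          by (rule borel_measurable_integrable)
        show "AE z in circle_measure. \<psi> z * cnj z ^ N k = I_minus_rot \<alpha> (I_minus_rot \<beta> h) z * cnj z ^ N k"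
          using ae by eventually_elim simp
      qed
      then have "norm (fourier \<psi> (N k)) = d k * (e k * norm (fourier h (N k)))"
        by (simp add: fourier_I_minus_rot h integrable_I_minus_rot norm_mult d_def e_def)
      moreover have "a k \<le> norm (fourier \<psi> (N k))"
        unfolding \<psi>_def [abs_def] by (rule coeff_le_norm_fourier_series [OF sa a0])
      \<comment> \<open>The product \<open>d k * e k\<close> is rewritten as minimum times maximum.
        The positive minimum cancels against the one in \<open>a k\<close>; the remaining maximum is
        below \<open>(1/4) ^ k\<close>, which beats the weight \<open>(1/2) ^ k\<close>.\<close>
      ultimately have "(1/2) ^ k * min (d k) (e k) \<le> min (d k) (e k) * (max (d k) (e k) * norm (fourier h (N k)))"
        by (cases "d k \<le> e k") (simp_all add: a_def mult_ac)
      then have "(1/2) ^ k \<le> max (d k) (e k) * norm (fourier h (N k))"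
        using pos [of k] by (simp add: mult.commute)
      also have "\<dots> \<le> (1/4) ^ k * norm (fourier h (N k))"
        using N(2,3) [of k] by (intro mult_right_mono) (auto simp: d_def e_def)
      finally have "4 ^ k * (1/2) ^ k \<le> norm (fourier h (N k))"
        by (simp add: power_divide field_simps)
      then have "2 ^ k \<le> norm (fourier h (N k))"
        by (simp add: power_mult_distrib [symmetric])
      also have "\<dots> \<le> (\<integral>z. norm (h z) \<partial>circle_measure)"
        by (rule norm_fourier_le [OF h])
      finally show ?thesis .
    qed
    obtain k where "(\<integral>z. norm (h z) \<partial>circle_measure) < 2 ^ k"
      using real_arch_pow [of 2] by auto
    with bound [of k] show False
      by simp
  qed
  with \<psi>\<alpha> \<psi>\<beta> that show ?thesis by blast
qed

theorem theorem4p5: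
  fixes \<alpha> \<beta> :: real
  assumes "\<alpha> \<notin> \<rat>" and "\<beta> \<notin> \<rat>"
  shows "(\<exists>\<psi> \<in> coboundaries_C \<alpha> \<inter> coboundaries_C \<beta>.
            \<not> (\<exists>h \<in> Lp_circle 1. AE z in circle_measure.
                 I_minus_rot \<alpha> (I_minus_rot \<beta> h) z = \<psi> z)) \<and>
         (\<forall>p::real. 1 \<le> p \<longrightarrow>
            (\<exists>\<psi> \<in> coboundaries_Lp p \<alpha> \<inter> coboundaries_Lp p \<beta>.
               \<not> (\<exists>h \<in> Lp_circle 1. AE z in circle_measure.
                    I_minus_rot \<alpha> (I_minus_rot \<beta> h) z = \<psi> z)))"
proof -
  obtain \<psi> where \<psi>: "\<psi> \<in> coboundaries_C \<alpha>" "\<psi> \<in> coboundaries_C \<beta>"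
    "\<not> (\<exists>h \<in> Lp_circle 1. AE z in circle_measure. I_minus_rot \<alpha> (I_minus_rot \<beta> h) z = \<psi> z)"
    using exists_joint_not_double_coboundary [OF assms] .
  \<comment> \<open>The same continuous function serves for every exponent \<open>p\<close>.\<close>
  have "\<psi> \<in> coboundaries_Lp p \<alpha> \<inter> coboundaries_Lp p \<beta>" if "1 \<le> p" for p
    using \<psi>(1,2) coboundaries_C_subset_Lp [of p] that by auto
  with \<psi> show ?thesis by blast
qed

end
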